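(* Let $((X_i)_{i\in N},(C_i)_{i\in N})$ be a game in choice form such that for each $x\in X$ there exists $i\in N$ with $C_i(x_{-i})\neq\emptyset$. Assume that, for each $i\in N$, the following conditions are fulfilled: (a) $X_i$ is a nonempty convex compact metrizable set in a locally convex space $E_i$, and $C_i$ is nonempty; (b) $W_i=\{x_{-i}\in X_{-i}: C_i(x_{-i})\neq\emptyset\}$ is an $(n_i-1)$-dimensional simplex in $X_{-i}$ (for some positive integer $n_i$); (c) there exists a WCG correspondence $S_i:W_i\to 2^{X_i}$ such that $S_i(x_{-i})\subset C_i(x_{-i})$ for each $x_{-i}\in W_i$; (d) $C_i(x_{-i})$ is convex or empty for each $x_{-i}\in X_{-i}$. Then the game admits an equilibrium in choice.
   Context: $N=\{1,\dots,n\}$ is a finite set of players, $X=\prod_{i\in N}X_i$, $X_{-i}=\prod_{j\neq i}X_j$ (product topologies), $x_{-i}=(x_1,\dots,x_{i-1},x_{i+1},\dots,x_n)$, and $x=(x_{-i},x_i)$. A game in choice form is a double family $((X_i)_{i\in N},(C_i)_{i\in N})$, where the $X_i$ are nonempty sets and $(C_i)_{i\in N}$ is a collection of nonempty subsets of $X$. The upper section of $C_i$ through $x_{-i}$ is $C_i(x_{-i})=\{y_i\in X_i:(x_{-i},y_i)\in C_i\}$. An element $x^*\in X$ is an equilibrium in choice if $x_i^*\in C_i(x_{-i}^* )$ for every $i\in N$ for which $C_i(x_{-i}^* )\neq\emptyset$. Weakly convex graph: let $K$ be a nonempty convex subset of a topological vector space and $Y$ a nonempty subset of a topological vector space. A correspondence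 $T:K\to 2^Y$ ($2^Y$ is the family of all subsets of $Y$) has weakly convex graph (is a WCG correspondence) if for each $m\in\mathbb N$ and each finite set $\{x_1,\dots,x_m\}\subset K$ there exist $y_j\in T(x_j)$, $j=1,\dots,m$, such that $\mathrm{co}\{(x_1,y_1),\dots,(x_m,y_m)\}\subset \mathrm{Gr}(T)$, where $\mathrm{Gr}(T)=\{(x,y)\in K\times Y: y\in T(x)\}$ and $\mathrm{co}$ denotes convex hull. *)

theory Defs
  imports "HOL-Analysis.Analysis" "HOL-Library.Function_Algebras"
begin

instantiation "fun" :: (type, real_vector) real_vector
begin

definition scaleR_fun :: "real \<Rightarrow> ('a \<Rightarrow> 'b) \<Rightarrow> 'a \<Rightarrow> 'b"
  where "scaleR_fun c f = (\<lambda>x. c *\<^sub>R f x)"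

instance
  by standard
    (simp_all add: scaleR_fun_def fun_eq_iff scaleR_add_right scaleR_add_left)

end

(* A topological vector space is a linear subspace of an ambient real vector space together with a
   topology whose underlying set is that subspace. A family of spaces over different carriers
   embeds into one ambient space (their direct sum), the topologies staying independent of each
   other. Hausdorffness is not part of the definition. *)

definition topological_vector_space :: "'v::real_vector topology \<Rightarrow> bool"
  where "topological_vector_space E \<longleftrightarrow>
    subspace (topspace E) \<and>
    continuous_map (prod_topology E E) E (\<lambda>(x, y). x + y) \<and>
    continuous_map (prod_topology euclideanreal E) E (\<lambda>(c, x). c *\<^sub>R x)"

definition locally_convex_space :: "'v::real_vector topology \<Rightarrow> bool"
  where "locally_convex_space E \<longleftrightarrow>
    topological_vector_space E \<and>
    (\<forall>U. openin E U \<and> 0 \<in> U \<longrightarrow> (\<exists>V. openin E V \<and> 0 \<in> V \<and> convex V \<and> V \<subseteq> U))"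

(* The product of the X j over j in J, with coordinates outside J set to 0 (rather than to
   undefined, as in PiE), so that it sits in the product vector space and convex combinations are
   the coordinatewise ones. Consequently, for x in the full product, x(i := 0) is the profile
   without the coordinate i, and z(i := y) adjoins y to such a profile z. *)

definition profiles :: "nat set \<Rightarrow> (nat \<Rightarrow> 'v::zero set) \<Rightarrow> (nat \<Rightarrow> 'v) set"
  where "profiles J X = {x. (\<forall>j\<in>J. x j \<in> X j) \<and> (\<forall>j. j \<notin> J \<longrightarrow> x j = 0)}"

definition game_in_choice_form ::
    "nat \<Rightarrow> (nat \<Rightarrow> 'v::zero set) \<Rightarrow> (nat \<Rightarrow> (nat \<Rightarrow> 'v) set) \<Rightarrow> bool"
  where "game_in_choice_form n X C \<longleftrightarrow>
    (\<forall>i\<in>{1..n}. X i \<noteq> {} \<and> C i \<noteq> {} \<and> C i \<subseteq> profiles {1..n} X)"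

definition upper_section ::
    "(nat \<Rightarrow> 'v set) \<Rightarrow> (nat \<Rightarrow> (nat \<Rightarrow> 'v) set) \<Rightarrow> nat \<Rightarrow> (nat \<Rightarrow> 'v) \<Rightarrow> 'v set"
  where "upper_section X C i z = {y \<in> X i. z(i := y) \<in> C i}"

definition upper_domain ::
    "nat \<Rightarrow> (nat \<Rightarrow> 'v::zero set) \<Rightarrow> (nat \<Rightarrow> (nat \<Rightarrow> 'v) set) \<Rightarrow> nat \<Rightarrow> (nat \<Rightarrow> 'v) set"
  where "upper_domain n X C i =
    {z \<in> profiles ({1..n} - {i}) X. upper_section X C i z \<noteq> {}}"

definition equilibrium_in_choice ::
    "nat \<Rightarrow> (nat \<Rightarrow> 'v::zero set) \<Rightarrow> (nat \<Rightarrow> (nat \<Rightarrow> 'v) set) \<Rightarrow> (nat \<Rightarrow> 'v) \<Rightarrow> bool"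
  where "equilibrium_in_choice n X C x \<longleftrightarrow>
    x \<in> profiles {1..n} X \<and>
    (\<forall>i\<in>{1..n}. upper_section X C i (x(i := 0)) \<noteq> {} \<longrightarrow>
      x i \<in> upper_section X C i (x(i := 0)))"

(* The library's simplex is restricted to Euclidean spaces. *)

definition simplex_of_dim :: "nat \<Rightarrow> 'a::real_vector set \<Rightarrow> bool"
  where "simplex_of_dim d S \<longleftrightarrow>
    (\<exists>V. finite V \<and> card V = d + 1 \<and> \<not> affine_dependent V \<and> S = convex hull V)"

definition corr_graph :: "'a set \<Rightarrow> 'b set \<Rightarrow> ('a \<Rightarrow> 'b set) \<Rightarrow> ('a \<times> 'b) set"
  where "corr_graph K Y T = {(x, y). x \<in> K \<and> y \<in> Y \<and> y \<in> T x}"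

(* Having a weakly convex graph does not depend on the topologies of the spaces containing
   K and Y. *)

definition weakly_convex_graph ::
    "'a::real_vector set \<Rightarrow> 'b::real_vector set \<Rightarrow> ('a \<Rightarrow> 'b set) \<Rightarrow> bool"
  where "weakly_convex_graph K Y T \<longleftrightarrow>
    K \<noteq> {} \<and> convex K \<and> Y \<noteq> {} \<and> (\<forall>x\<in>K. T x \<subseteq> Y) \<and>
    (\<forall>(m::nat) x. (\<forall>j\<in>{1..m}. x j \<in> K) \<longrightarrow>
      (\<exists>y. (\<forall>j\<in>{1..m}. y j \<in> T (x j)) \<and>
           convex hull ((\<lambda>j. (x j, y j)) ` {1..m}) \<subseteq> corr_graph K Y T))"

end

theory Submission
  imports Defs
begin

text \<open>
  Weak convexity of the graph of \<open>S i\<close>, applied to the vertices \<open>v\<close> of the simplex \<open>W i\<close>,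
  yields points \<open>y i v\<close> such that the affine map sending \<open>v\<close> to \<open>y i v\<close> is a selection of
  \<open>S i\<close> on \<open>W i\<close>. So it suffices to look for profiles whose coordinate \<open>i\<close> is a convex
  combination of the \<open>y i v\<close> with weights \<open>t (i, v)\<close>. The barycentric coordinates of \<open>W i\<close>
  extend to affine functionals on the whole space; the map that sends \<open>t\<close> to the normalised
  positive parts of these functionals at the profile without coordinate \<open>i\<close> is a continuous self-map
  of a cube of finite dimension. At a fixed point, the weights \<open>t (i, v)\<close> are the barycentric
  coordinates whenever the profile without coordinate \<open>i\<close> lies in \<open>W i\<close>, so coordinate \<open>i\<close> is the
  value of the selection there. Thus Brouwer's theorem for cubes replaces the fixed point theorem of
  Kakutani, Fan and Glicksberg.
\<close>

text \<open>
  The dimension of the cube depends on the game, so the library's Brouwer theorem, whose dimension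
  is a type, does not apply; Kuhn's combinatorial lemma, on which it rests, does.
\<close>

lemma brouwer_unit_cube_step:
  fixes f :: "('i \<Rightarrow> real) \<Rightarrow> 'i \<Rightarrow> real" and p :: nat
  assumes fin: "finite I" and p: "0 < p"
    and maps: "\<And>x i. x \<in> PiE I (\<lambda>_. {0..1}) \<Longrightarrow> i \<in> I \<Longrightarrow> f x i \<in> {0..1}"
  obtains q where "q \<in> PiE I (\<lambda>_. {0..1})"
    and "\<And>i. i \<in> I \<Longrightarrow> \<exists>a\<in>PiE I (\<lambda>_. {0..1}). \<exists>b\<in>PiE I (\<lambda>_. {0..1}).
           (\<forall>j\<in>I. \<bar>a j - q j\<bar> \<le> 1 / p \<and> \<bar>b j - q j\<bar> \<le> 1 / p) \<and> a i \<le> f a i \<and> f b i \<le> b i"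
proof -
  define n where "n = card I"
  obtain h where h: "bij_betw h I {..<n}"
    using ex_bij_betw_finite_nat[OF fin] unfolding n_def lessThan_atLeast0 by blast
  define g where "g = inv_into I h"
  have hn: "h i < n" and gh: "g (h i) = i" if "i \<in> I" for i
    using h that by (auto simp: bij_betw_def g_def)
  have gI: "g k \<in> I" and hg: "h (g k) = k" if "k < n" for k
    using h that by (auto simp: bij_betw_def g_def inv_into_into f_inv_into_f)
  \<comment> \<open>\<open>pt\<close> reads an integer vector as a point of the grid of mesh
    \<open>1 / p\<close>. The bijection \<open>h\<close> renames the coordinates \<open>I\<close> to
    \<open>0, ..., n - 1\<close>, as Kuhn's lemma expects.\<close>
  define pt where "pt u = (\<lambda>i\<in>I. real (u (h i)) / p)" for u :: "nat \<Rightarrow> nat"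
  \<comment> \<open>The test \<open>u k < p\<close> forces label 1 on the upper face even where \<open>f\<close> fixes the coordinate.\<close>
  define label :: "(nat \<Rightarrow> nat) \<Rightarrow> nat \<Rightarrow> nat"
    where "label u k = (if u k < p \<and> pt u (g k) \<le> f (pt u) (g k) then 0 else 1)" for u k
  have pt_cube: "pt u \<in> PiE I (\<lambda>_. {0..1})" if "\<forall>k<n. u k \<le> p" for u
    using that p hn by (auto simp: pt_def)
  have pt_g: "pt u (g k) = real (u k) / p" if "k < n" for u k
    using that by (simp add: pt_def gI hg)
  have label0: "pt u (g k) \<le> f (pt u) (g k)" if "label u k = 0" for u k
    using that by (simp add: label_def split: if_splits)
  have label1: "f (pt u) (g k) \<le> pt u (g k)" if "label u k \<noteq> 0" "\<forall>k<n. u k \<le> p" "k < n" for u k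
  proof (cases "u k < p")
    case True
    then show ?thesis using that(1) by (simp add: label_def split: if_splits)
  next
    case False
    then have "u k = p" using that by (simp add: order_antisym)
    then have "pt u (g k) = 1" using pt_g that p by simp
    then show ?thesis using maps[OF pt_cube gI] that by auto
  qed
  \<comment> \<open>Kuhn's boundary conditions ask for label 0 where a coordinate is 0, which holds
    since \<open>f\<close> is nonnegative, and for label 1 where it is \<open>p\<close>, which is
    built into \<open>label\<close>.\<close>
  obtain q where q: "\<forall>i<n. q i < p"
    and rs: "\<forall>i<n. \<exists>r s. (\<forall>j<n. q j \<le> r j \<and> r j \<le> q j + 1) \<and>
               (\<forall>j<n. q j \<le> s j \<and> s j \<le> q j + 1) \<and> label r i \<noteq> label s i"
  proof (rule kuhn_lemma[OF p, of n label])
    show "\<forall>x. (\<forall>i<n. x i \<le> p) \<longrightarrow> (\<forall>i<n. x i = 0 \<longrightarrow> label x i = 0)"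
      using maps[OF pt_cube gI] p by (auto simp: label_def pt_g)
  qed (auto simp: label_def)
  show thesis
  proof (rule that[of "pt q"])
    show "pt q \<in> PiE I (\<lambda>_. {0..1})"
      using q pt_cube by (simp add: less_imp_le)
  next
    fix i assume i: "i \<in> I"
    have near: "\<bar>pt r j - pt q j\<bar> \<le> 1 / p" if "\<forall>j<n. q j \<le> r j \<and> r j \<le> q j + 1" "j \<in> I" for r j
    proof -
      have "\<bar>real (r (h j)) - real (q (h j))\<bar> \<le> 1"
        using that hn[OF \<open>j \<in> I\<close>] by fastforce
      then show ?thesis
        using that p by (simp add: pt_def abs_divide divide_right_mono flip: diff_divide_distrib)
    qed
    \<comment> \<open>Kuhn's lemma does not tell which of the two corners carries label 0, so the
      claim is proved for an ordered pair and later used in both orders.\<close>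
    have *: "\<exists>a\<in>PiE I (\<lambda>_. {0..1}). \<exists>b\<in>PiE I (\<lambda>_. {0..1}).
           (\<forall>j\<in>I. \<bar>a j - pt q j\<bar> \<le> 1 / p \<and> \<bar>b j - pt q j\<bar> \<le> 1 / p) \<and> a i \<le> f a i \<and> f b i \<le> b i"
      if r: "\<forall>j<n. q j \<le> r j \<and> r j \<le> q j + 1" and s: "\<forall>j<n. q j \<le> s j \<and> s j \<le> q j + 1"
        and "label r (h i) = 0" "label s (h i) \<noteq> 0" for r s
    proof -
      have le: "\<forall>k<n. r k \<le> p" "\<forall>k<n. s k \<le> p"
        using r s q by fastforce+
      have "pt r i \<le> f (pt r) i" "f (pt s) i \<le> pt s i"
        using label0[of r "h i"] label1[of s "h i"] that(3,4) le gh[OF i] hn[OF i] by auto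
      then show ?thesis
        using near[OF r] near[OF s]
        by (intro bexI[OF _ pt_cube[OF le(1)]] bexI[OF _ pt_cube[OF le(2)]]) simp
    qed
    obtain r s where r: "\<forall>j<n. q j \<le> r j \<and> r j \<le> q j + 1"
      and s: "\<forall>j<n. q j \<le> s j \<and> s j \<le> q j + 1"
      and neq: "label r (h i) \<noteq> label s (h i)"
      using rs hn[OF i] by blast
    have "label r (h i) = 0 \<or> label s (h i) = 0"
      using neq by (auto simp: label_def split: if_splits)
    with neq consider "label r (h i) = 0" "label s (h i) \<noteq> 0" | "label s (h i) = 0" "label r (h i) \<noteq> 0"
      by (cases "label r (h i) = 0") auto
    then show "\<exists>a\<in>PiE I (\<lambda>_. {0..1}). \<exists>b\<in>PiE I (\<lambda>_. {0..1}).
           (\<forall>j\<in>I. \<bar>a j - pt q j\<bar> \<le> 1 / p \<and> \<bar>b j - pt q j\<bar> \<le> 1 / p) \<and> a i \<le> f a i \<and> f b i \<le> b i"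
      using *[OF r s] *[OF s r] by cases
  qed
qed

text \<open>In a grid cell of mesh \<open>1 / Suc k\<close>, each coordinate of
  \<open>f x - x\<close> is nonnegative at some corner and nonpositive at another. Along a
  subsequence the cells shrink to one point, where continuity turns the two signs into
  equality.\<close>

lemma brouwer_unit_cube:
  fixes f :: "('i \<Rightarrow> real) \<Rightarrow> 'i \<Rightarrow> real"
  assumes fin: "finite I"
    and cont: "\<And>i. i \<in> I \<Longrightarrow> continuous_on (PiE I (\<lambda>_. {0..1})) (\<lambda>x. f x i)"
    and maps: "\<And>x i. x \<in> PiE I (\<lambda>_. {0..1}) \<Longrightarrow> i \<in> I \<Longrightarrow> f x i \<in> {0..1}"
  obtains x where "x \<in> PiE I (\<lambda>_. {0..1})" "\<And>i. i \<in> I \<Longrightarrow> f x i = x i"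
proof -
  let ?Q = "PiE I (\<lambda>_. {0..1::real})"
  have "\<exists>q. q \<in> ?Q \<and> (\<forall>i\<in>I. \<exists>a\<in>?Q. \<exists>b\<in>?Q.
           (\<forall>j\<in>I. \<bar>a j - q j\<bar> \<le> 1 / Suc k \<and> \<bar>b j - q j\<bar> \<le> 1 / Suc k) \<and> a i \<le> f a i \<and> f b i \<le> b i)" for k
    using brouwer_unit_cube_step[of I "Suc k" f, OF fin zero_less_Suc maps] by (metis (no_types, lifting))
  then obtain q where qQ: "\<And>k. q k \<in> ?Q"
    and q: "\<And>k i. i \<in> I \<Longrightarrow> \<exists>a\<in>?Q. \<exists>b\<in>?Q.
           (\<forall>j\<in>I. \<bar>a j - q k j\<bar> \<le> 1 / Suc k \<and> \<bar>b j - q k j\<bar> \<le> 1 / Suc k) \<and> a i \<le> f a i \<and> f b i \<le> b i"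
    by metis
  \<comment> \<open>The two corners depend on the coordinate \<open>i\<close> as well as on
    \<open>k\<close>. \<open>R\<close> collects their properties so that both can be chosen as
    functions of \<open>k\<close> and \<open>i\<close>.\<close>
  define R where "R k i a b \<longleftrightarrow> a \<in> ?Q \<and> b \<in> ?Q \<and> a i \<le> f a i \<and> f b i \<le> b i \<and>
      (\<forall>j\<in>I. \<bar>a j - q k j\<bar> \<le> 1 / Suc k \<and> \<bar>b j - q k j\<bar> \<le> 1 / Suc k)" for k i a b
  define a where "a k i = (SOME a. \<exists>b. R k i a b)" for k i
  define b where "b k i = (SOME b. R k i (a k i) b)" for k i
  have "R k i (a k i) (b k i)" if "i \<in> I" for k i
  proof -
    have "\<exists>a b. R k i a b"
      using q[OF that] unfolding R_def by blast
    then have "\<exists>b. R k i (a k i) b"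
      unfolding a_def by (rule someI_ex)
    then show ?thesis
      unfolding b_def by (rule someI_ex)
  qed
  then have aQ: "\<And>k i. i \<in> I \<Longrightarrow> a k i \<in> ?Q" and bQ: "\<And>k i. i \<in> I \<Longrightarrow> b k i \<in> ?Q"
    and a_near: "\<And>k i j. i \<in> I \<Longrightarrow> j \<in> I \<Longrightarrow> \<bar>a k i j - q k j\<bar> \<le> 1 / Suc k"
    and b_near: "\<And>k i j. i \<in> I \<Longrightarrow> j \<in> I \<Longrightarrow> \<bar>b k i j - q k j\<bar> \<le> 1 / Suc k"
    and a_le: "\<And>k i. i \<in> I \<Longrightarrow> a k i i \<le> f (a k i) i"
    and b_le: "\<And>k i. i \<in> I \<Longrightarrow> f (b k i) i \<le> b k i i"
    unfolding R_def by blast+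
  \<comment> \<open>Bolzano-Weierstrass for finitely many coordinates: a single subsequence
    \<open>r\<close> makes all of them converge.\<close>
  have "\<forall>d\<subseteq>I. \<exists>l::'i \<Rightarrow> real. \<exists>r::nat \<Rightarrow> nat. strict_mono r \<and>
          (\<forall>e>0. eventually (\<lambda>k. \<forall>i\<in>d. dist (q (r k) i) (l i) < e) sequentially)"
  proof (rule compact_lemma_general[where unproj = "\<lambda>x. x", OF fin])
    fix i assume "i \<in> I"
    then show "bounded ((\<lambda>x. x i) ` range q)"
      using qQ by (intro bounded_subset[OF bounded_closed_interval[of 0 1]]) fastforce
  qed auto
  then obtain l :: "'i \<Rightarrow> real" and r :: "nat \<Rightarrow> nat" where r: "strict_mono r"
    and l: "\<And>e. e > 0 \<Longrightarrow> eventually (\<lambda>k. \<forall>i\<in>I. dist (q (r k) i) (l i) < e) sequentially"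
    by blast
  define x where "x = restrict l I"
  have q_tendsto: "(\<lambda>k. q (r k) i) \<longlonglongrightarrow> x i" if "i \<in> I" for i
  proof (rule tendstoI)
    fix e :: real assume "0 < e"
    from l[OF this] show "eventually (\<lambda>k. dist (q (r k) i) (x i) < e) sequentially"
      by (rule eventually_mono) (use that in \<open>simp add: x_def\<close>)
  qed
  have xQ: "x \<in> ?Q"
  proof (rule PiE_I)
    fix i assume i: "i \<in> I"
    have "\<And>k. q (r k) i \<in> {0..1}" using qQ i by blast
    then show "x i \<in> {0..1}"
      using closed_sequentially[OF closed_atLeastAtMost _ q_tendsto[OF i]] by blast
  qed (simp add: x_def)
  have lim: "(\<lambda>k. c (r k)) \<longlonglongrightarrow> x"
    if cQ: "\<And>k. c k \<in> ?Q" and near: "\<And>k j. j \<in> I \<Longrightarrow> \<bar>c k j - q k j\<bar> \<le> 1 / Suc k" for c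
  proof -
    \<comment> \<open>Convergence in the function space is tested at every index. Outside
      \<open>I\<close> all points of the cube share the same default value, which is why
      \<open>x\<close> is \<open>l\<close> restricted to \<open>I\<close>.\<close>
    have "(\<lambda>k. c (r k) j) \<longlonglongrightarrow> x j" for j
    proof (cases "j \<in> I")
      case True
      have "(\<lambda>k. c k j - q k j) \<longlonglongrightarrow> 0"
        by (rule Lim_null_comparison[OF _ LIMSEQ_Suc[OF lim_1_over_n]])
          (use near[OF True] in auto)
      from tendsto_add[OF LIMSEQ_subseq_LIMSEQ[OF this r] q_tendsto[OF True]]
      show ?thesis by (simp add: o_def)
    next
      case False
      then have "c k j = x j" for k
        using PiE_arb[OF cQ] PiE_arb[OF xQ] by simp
      then show ?thesis by simp
    qed
    then show ?thesis
      using limitin_componentwise[of "\<lambda>_. euclideanreal" UNIV "\<lambda>k. c (r k)" x sequentially]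
      by (simp add: euclidean_product_topology)
  qed
  have flim: "(\<lambda>k. f (c (r k)) i) \<longlonglongrightarrow> f x i"
    if "\<And>k. c k \<in> ?Q" "(\<lambda>k. c (r k)) \<longlonglongrightarrow> x" "i \<in> I" for c i
    using continuous_on_tendsto_compose[OF cont[OF that(3)] that(2) xQ] that(1) by simp
  have coord: "(\<lambda>k. c (r k) i) \<longlonglongrightarrow> x i" if "(\<lambda>k. c (r k)) \<longlonglongrightarrow> x" for c i
    using continuous_on_tendsto_compose[OF continuous_on_product_coordinates[of i] that] by simp
  have fixed: "f x i = x i" if i: "i \<in> I" for i
  proof (rule antisym)
    note a_lim = lim[of "\<lambda>k. a k i", OF aQ[OF i] a_near[OF i]]
    show "x i \<le> f x i"
      by (rule LIMSEQ_le[OF coord[of "\<lambda>k. a k i", OF a_lim] flim[of "\<lambda>k. a k i", OF aQ[OF i] a_lim i]])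
        (use a_le[OF i] in auto)
    note b_lim = lim[of "\<lambda>k. b k i", OF bQ[OF i] b_near[OF i]]
    show "f x i \<le> x i"
      by (rule LIMSEQ_le[OF flim[of "\<lambda>k. b k i", OF bQ[OF i] b_lim i] coord[of "\<lambda>k. b k i", OF b_lim]])
        (use b_le[OF i] in auto)
  qed
  show thesis by (rule that[OF xQ fixed])
qed

text \<open>Moving a vertex to the origin turns affine into linear independence, so dual linear
  functionals exist and extend to the whole space. Hence the coordinates make sense at points
  outside the simplex too.\<close>

lemma barycentric_coordinates:
  fixes V :: "'a::real_vector set"
  assumes fin: "finite V" and ne: "V \<noteq> {}" and indep: "\<not> affine_dependent V"
  obtains b :: "'a \<Rightarrow> 'a \<Rightarrow> real"
  where "\<And>v. v \<in> V \<Longrightarrow> \<exists>c L. linear L \<and> b v = (\<lambda>x. c + L x)"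
    and "\<And>x. (\<Sum>v\<in>V. b v x) = 1"
    and "\<And>x v. x \<in> convex hull V \<Longrightarrow> v \<in> V \<Longrightarrow> 0 \<le> b v x"
    and "\<And>x. x \<in> convex hull V \<Longrightarrow> (\<Sum>v\<in>V. b v x *\<^sub>R v) = x"
proof -
  obtain p where p: "p \<in> V" using ne by blast
  have ind: "independent ((\<lambda>x. - p + x) ` (V - {p}))"
    using indep affine_dependent_iff_dependent2[OF p] by blast
  have "\<exists>L. linear L \<and> (\<forall>w\<in>V - {p}. L (- p + w) = (if w = v then 1 else 0::real))" for v
    using linear_independent_extend[OF ind, of "\<lambda>z. if p + z = v then 1 else 0::real"] by auto
  then obtain L where lin: "\<And>v. linear (L v)"
    and Lw: "\<And>v w. w \<in> V - {p} \<Longrightarrow> L v (- p + w) = (if w = v then 1 else 0::real)"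
    by metis
  \<comment> \<open>The coordinate of the base vertex \<open>p\<close> is defined as the complement
    of the others, so the sum is 1 at every point, even off the affine hull of
    \<open>V\<close>.\<close>
  define b where "b v x = (if v = p then 1 - (\<Sum>w\<in>V - {p}. L w (- p + x)) else L v (- p + x))" for v x
  have aff: "\<exists>c M. linear M \<and> b v = (\<lambda>x. c + M x)" for v
  proof (cases "v = p")
    case True
    have "linear (\<lambda>x. - (\<Sum>w\<in>V - {p}. L w x))"
      by (intro linear_compose_neg linear_compose_sum) (use lin in auto)
    moreover have "b v = (\<lambda>x. (1 - (\<Sum>w\<in>V - {p}. L w (- p))) + - (\<Sum>w\<in>V - {p}. L w x))"
      using True by (auto simp: b_def linear_add[OF lin] sum.distrib simp del: uminus_add_conv_diff)
    ultimately show ?thesis by blast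
  next
    case False
    then have "b v = (\<lambda>x. L v (- p) + L v x)"
      by (auto simp: b_def linear_add[OF lin] simp del: uminus_add_conv_diff)
    with lin show ?thesis by blast
  qed
  have sum1: "(\<Sum>v\<in>V. b v x) = 1" for x
    by (simp add: sum.remove[OF fin p] b_def)
  have vert: "b v w = (if w = v then 1 else 0)" if "v \<in> V" "w \<in> V" for v w
  proof -
    have "L u (- p + w) = (if w = u then 1 else 0)" if "u \<in> V - {p}" for u
      using Lw[of w u] \<open>w \<in> V\<close> linear_0[OF lin[of u]] that by (cases "w = p") auto
    then show ?thesis
      using that fin by (auto simp: b_def)
  qed
  \<comment> \<open>An affine functional commutes with combinations of total weight 1, and
    \<open>b v\<close> is 1 at \<open>v\<close> and 0 at the other vertices; so it reads off the
    weight of \<open>v\<close>.\<close>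
  have comb: "b v (\<Sum>w\<in>V. u w *\<^sub>R w) = u v" if "sum u V = 1" "v \<in> V" for u v
  proof -
    obtain c M where M: "linear M" "b v = (\<lambda>x. c + M x)" using aff by blast
    have "b v (\<Sum>w\<in>V. u w *\<^sub>R w) = (\<Sum>w\<in>V. u w) * c + (\<Sum>w\<in>V. u w * M w)"
      using that by (simp add: M(2) linear_sum[OF M(1)] linear_scale[OF M(1)])
    also have "\<dots> = (\<Sum>w\<in>V. u w * b v w)"
      by (simp add: M(2) sum_distrib_right distrib_left sum.distrib)
    also have "\<dots> = (\<Sum>w\<in>V. if w = v then u w else 0)"
      using that by (intro sum.cong) (auto simp: vert)
    also have "\<dots> = u v"
      using that fin by simp
    finally show ?thesis .
  qed
  have hull: "(\<forall>v\<in>V. 0 \<le> b v x) \<and> (\<Sum>v\<in>V. b v x *\<^sub>R v) = x" if "x \<in> convex hull V" for x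
  proof -
    have "\<exists>u. (\<forall>v\<in>V. 0 \<le> u v) \<and> sum u V = 1 \<and> (\<Sum>v\<in>V. u v *\<^sub>R v) = x"
      using that unfolding convex_hull_finite[OF fin] mem_Collect_eq .
    then obtain u where u: "\<forall>v\<in>V. 0 \<le> u v" "sum u V = 1" and x: "(\<Sum>v\<in>V. u v *\<^sub>R v) = x"
      by (elim exE conjE)
    have "b v x = u v" if "v \<in> V" for v
      using comb[OF u(2) that] by (simp add: x)
    then show ?thesis using u x by simp
  qed
  show thesis
    by (rule that[of b, OF aff sum1]) (use hull in blast)+
qed

text \<open>Weak convexity speaks of indexed lists of points. Enumerating \<open>V\<close> without
  repetition makes the chosen values a function of the vertex itself.\<close>

lemma weakly_convex_graph_selection:
  assumes wcg: "weakly_convex_graph K Y T" and fin: "finite V" and "V \<subseteq> K"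
  obtains y where "\<forall>v\<in>V. y v \<in> T v"
    and "convex hull ((\<lambda>v. (v, y v)) ` V) \<subseteq> corr_graph K Y T"
proof -
  obtain h where h: "bij_betw h {1..card V} V"
    using ex_bij_betw_nat_finite_1[OF fin] by blast
  then have img: "h ` {1..card V} = V" and inj: "inj_on h {1..card V}"
    by (auto simp: bij_betw_def)
  have "\<forall>j\<in>{1..card V}. h j \<in> K"
    using img \<open>V \<subseteq> K\<close> by blast
  then obtain y where y: "\<forall>j\<in>{1..card V}. y j \<in> T (h j)"
    and co: "convex hull ((\<lambda>j. (h j, y j)) ` {1..card V}) \<subseteq> corr_graph K Y T"
    using wcg unfolding weakly_convex_graph_def by blast
  define g where "g = inv_into {1..card V} h"
  have gh: "g (h j) = j" if "j \<in> {1..card V}" for j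
    using that inj by (simp add: g_def)
  have "(\<lambda>v. (v, y (g v))) ` (h ` {1..card V}) = (\<lambda>j. (h j, y j)) ` {1..card V}"
    unfolding image_image by (rule image_cong[OF refl]) (simp add: gh)
  then have "convex hull ((\<lambda>v. (v, y (g v))) ` V) \<subseteq> corr_graph K Y T"
    using co by (simp only: img)
  moreover have "\<forall>v\<in>h ` {1..card V}. y (g v) \<in> T v"
    using y gh by simp
  then have "\<forall>v\<in>V. y (g v) \<in> T v"
    by (simp only: img)
  ultimately show thesis
    by (intro that)
qed

lemma sum_fun_apply: "(\<Sum>i\<in>A. f i) x = (\<Sum>i\<in>A. f i x)"
  for f :: "'i \<Rightarrow> 'a \<Rightarrow> 'b::comm_monoid_add"
  by (induction A rule: infinite_finite_induct) auto

theorem theorem2: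
  fixes n :: nat
    and E :: "nat \<Rightarrow> 'v::real_vector topology"
    and X :: "nat \<Rightarrow> 'v set"
    and C :: "nat \<Rightarrow> (nat \<Rightarrow> 'v) set"
  assumes game: "game_in_choice_form n X C"
    and covered: "\<forall>x\<in>profiles {1..n} X. \<exists>i\<in>{1..n}. upper_section X C i (x(i := 0)) \<noteq> {}"
    and a: "\<forall>i\<in>{1..n}. locally_convex_space (E i) \<and> X i \<noteq> {} \<and> X i \<subseteq> topspace (E i) \<and>
              convex (X i) \<and> compactin (E i) (X i) \<and>
              metrizable_space (subtopology (E i) (X i)) \<and> C i \<noteq> {}"
    and b: "\<forall>i\<in>{1..n}. \<exists>k\<ge>1. simplex_of_dim (k - 1) (upper_domain n X C i)"
    and c: "\<forall>i\<in>{1..n}. \<exists>S. weakly_convex_graph (upper_domain n X C i) (X i) S \<and>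
              (\<forall>z\<in>upper_domain n X C i. S z \<subseteq> upper_section X C i z)"
    and d: "\<forall>i\<in>{1..n}. \<forall>z\<in>profiles ({1..n} - {i}) X.
              convex (upper_section X C i z) \<or> upper_section X C i z = {}"
  shows "\<exists>x. equilibrium_in_choice n X C x"
proof -
  let ?N = "{1..n}"
  let ?W = "upper_domain n X C"
  have "\<forall>i\<in>?N. \<exists>V. finite V \<and> V \<noteq> {} \<and> \<not> affine_dependent V \<and> ?W i = convex hull V"
  proof
    fix i assume "i \<in> ?N"
    then obtain k V where "finite V" "card V = k + 1" "\<not> affine_dependent V" "?W i = convex hull V"
      using b unfolding simplex_of_dim_def by blast
    then show "\<exists>V. finite V \<and> V \<noteq> {} \<and> \<not> affine_dependent V \<and> ?W i = convex hull V"
      by (intro exI[of _ V]) auto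
  qed
  from bchoice[OF this] obtain V where V: "\<forall>i\<in>?N. finite (V i) \<and> V i \<noteq> {} \<and>
      \<not> affine_dependent (V i) \<and> ?W i = convex hull (V i)" ..
  then have finV: "\<And>i. i \<in> ?N \<Longrightarrow> finite (V i)" and neV: "\<And>i. i \<in> ?N \<Longrightarrow> V i \<noteq> {}"
    and indV: "\<And>i. i \<in> ?N \<Longrightarrow> \<not> affine_dependent (V i)"
    and WV: "\<And>i. i \<in> ?N \<Longrightarrow> ?W i = convex hull (V i)"
    by simp_all
  have "\<forall>i\<in>?N. \<exists>y. (\<forall>v\<in>V i. y v \<in> X i) \<and>
          (\<forall>u. (\<forall>v\<in>V i. 0 \<le> u v) \<longrightarrow> sum u (V i) = 1 \<longrightarrow>
            (\<Sum>v\<in>V i. u v *\<^sub>R y v) \<in> upper_section X C i (\<Sum>v\<in>V i. u v *\<^sub>R v))"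
  proof
    fix i assume i: "i \<in> ?N"
    obtain S where wcg: "weakly_convex_graph (?W i) (X i) S"
      and S: "\<And>z. z \<in> ?W i \<Longrightarrow> S z \<subseteq> upper_section X C i z"
      using c i by blast
    have VW: "V i \<subseteq> ?W i"
      unfolding WV[OF i] by (rule hull_subset)
    obtain y where y: "\<forall>v\<in>V i. y v \<in> S v"
      and co: "convex hull ((\<lambda>v. (v, y v)) ` V i) \<subseteq> corr_graph (?W i) (X i) S"
      by (rule weakly_convex_graph_selection[OF wcg finV[OF i] VW])
    have "y v \<in> X i" if "v \<in> V i" for v
    proof -
      have "S v \<subseteq> X i"
        using that VW wcg unfolding weakly_convex_graph_def by (meson subsetD)
      then show ?thesis
        using y that by (meson bspec subsetD)
    qed
    moreover have "(\<Sum>v\<in>V i. u v *\<^sub>R y v) \<in> upper_section X C i (\<Sum>v\<in>V i. u v *\<^sub>R v)"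
      if "\<forall>v\<in>V i. 0 \<le> u v" "sum u (V i) = 1" for u
    proof -
      \<comment> \<open>The same weights act on both components of the pairs
        \<open>(v, y v)\<close>, so membership in the graph says that the affine map through the
        \<open>y v\<close> selects from \<open>S\<close>.\<close>
      have "(\<Sum>v\<in>V i. u v *\<^sub>R (v, y v)) \<in> convex hull ((\<lambda>v. (v, y v)) ` V i)"
        by (rule convex_sum[OF finV[OF i] convex_convex_hull that(2)])
          (use that(1) in \<open>auto intro: hull_inc\<close>)
      moreover have "(\<Sum>v\<in>V i. u v *\<^sub>R (v, y v)) = (\<Sum>v\<in>V i. u v *\<^sub>R v, \<Sum>v\<in>V i. u v *\<^sub>R y v)"
        by (simp add: sum_prod)
      ultimately show ?thesis
        using co S by (auto simp: corr_graph_def)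
    qed
    ultimately show "\<exists>y. (\<forall>v\<in>V i. y v \<in> X i) \<and>
          (\<forall>u. (\<forall>v\<in>V i. 0 \<le> u v) \<longrightarrow> sum u (V i) = 1 \<longrightarrow>
            (\<Sum>v\<in>V i. u v *\<^sub>R y v) \<in> upper_section X C i (\<Sum>v\<in>V i. u v *\<^sub>R v))"
      by blast
  qed
  from bchoice[OF this] obtain y where y: "\<forall>i\<in>?N. (\<forall>v\<in>V i. y i v \<in> X i) \<and>
          (\<forall>u. (\<forall>v\<in>V i. 0 \<le> u v) \<longrightarrow> sum u (V i) = 1 \<longrightarrow>
            (\<Sum>v\<in>V i. u v *\<^sub>R y i v) \<in> upper_section X C i (\<Sum>v\<in>V i. u v *\<^sub>R v))" ..
  then have yX: "\<And>i v. i \<in> ?N \<Longrightarrow> v \<in> V i \<Longrightarrow> y i v \<in> X i"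
    and y_sel: "\<And>i u. i \<in> ?N \<Longrightarrow> \<forall>v\<in>V i. 0 \<le> u v \<Longrightarrow> sum u (V i) = 1 \<Longrightarrow>
      (\<Sum>v\<in>V i. u v *\<^sub>R y i v) \<in> upper_section X C i (\<Sum>v\<in>V i. u v *\<^sub>R v)"
    by simp_all
  have "\<forall>i\<in>?N. \<exists>\<beta>. (\<forall>v\<in>V i. \<exists>c L. linear L \<and> \<beta> v = (\<lambda>x. c + L x)) \<and>
      (\<forall>x. (\<Sum>v\<in>V i. \<beta> v x) = (1::real)) \<and>
      (\<forall>x\<in>?W i. (\<forall>v\<in>V i. 0 \<le> \<beta> v x) \<and> (\<Sum>v\<in>V i. \<beta> v x *\<^sub>R v) = x)"
  proof
    fix i assume i: "i \<in> ?N"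
    show "\<exists>\<beta>. (\<forall>v\<in>V i. \<exists>c L. linear L \<and> \<beta> v = (\<lambda>x. c + L x)) \<and>
      (\<forall>x. (\<Sum>v\<in>V i. \<beta> v x) = (1::real)) \<and>
      (\<forall>x\<in>?W i. (\<forall>v\<in>V i. 0 \<le> \<beta> v x) \<and> (\<Sum>v\<in>V i. \<beta> v x *\<^sub>R v) = x)"
      unfolding WV[OF i]
      by (rule barycentric_coordinates[OF finV[OF i] neV[OF i] indV[OF i]]) blast
  qed
  from bchoice[OF this] obtain \<beta> where \<beta>: "\<forall>i\<in>?N.
      (\<forall>v\<in>V i. \<exists>c L. linear L \<and> \<beta> i v = (\<lambda>x. c + L x)) \<and>
      (\<forall>x. (\<Sum>v\<in>V i. \<beta> i v x) = (1::real)) \<and>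
      (\<forall>x\<in>?W i. (\<forall>v\<in>V i. 0 \<le> \<beta> i v x) \<and> (\<Sum>v\<in>V i. \<beta> i v x *\<^sub>R v) = x)" ..
  then have
    aff: "\<And>i v. i \<in> ?N \<Longrightarrow> v \<in> V i \<Longrightarrow> \<exists>c L. linear L \<and> \<beta> i v = (\<lambda>x. c + L x)"
    and sum1: "\<And>i x. i \<in> ?N \<Longrightarrow> (\<Sum>v\<in>V i. \<beta> i v x) = (1::real)"
    and \<beta>_nonneg: "\<And>i x v. i \<in> ?N \<Longrightarrow> x \<in> ?W i \<Longrightarrow> v \<in> V i \<Longrightarrow> 0 \<le> \<beta> i v x"
    and \<beta>_repr: "\<And>i x. i \<in> ?N \<Longrightarrow> x \<in> ?W i \<Longrightarrow> (\<Sum>v\<in>V i. \<beta> i v x *\<^sub>R v) = x"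
    by simp_all
  define P where "P t = (\<lambda>i. if i \<in> ?N then \<Sum>v\<in>V i. t (i, v) *\<^sub>R y i v else 0)" for t
  \<comment> \<open>The profile is written as a combination of finitely many fixed vectors, each
    carrying \<open>y l v\<close> at coordinate \<open>l\<close> and 0 elsewhere, with the entries
    of \<open>t\<close> as coefficients.\<close>
  have P_upd: "(P t)(i := 0) =
      (\<Sum>l\<in>?N - {i}. \<Sum>v\<in>V l. t (l, v) *\<^sub>R (\<lambda>j. if j = l then y l v else 0))" for t i
  proof
    fix j
    have "(\<Sum>l\<in>?N - {i}. \<Sum>v\<in>V l. t (l, v) *\<^sub>R (\<lambda>j. if j = l then y l v else 0)) j
        = (\<Sum>l\<in>?N - {i}. \<Sum>v\<in>V l. t (l, v) *\<^sub>R (if j = l then y l v else 0))"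
      by (simp add: sum_fun_apply scaleR_fun_def)
    also have "\<dots> = (\<Sum>l\<in>?N - {i}. if j = l then \<Sum>v\<in>V l. t (l, v) *\<^sub>R y l v else 0)"
      by (intro sum.cong) auto
    also have "\<dots> = ((P t)(i := 0)) j"
      by (simp add: P_def)
    finally show "((P t)(i := 0)) j =
        (\<Sum>l\<in>?N - {i}. \<Sum>v\<in>V l. t (l, v) *\<^sub>R (\<lambda>j. if j = l then y l v else 0)) j" ..
  qed
  have \<beta>_cont: "continuous_on A (\<lambda>t. \<beta> i v ((P t)(i := 0)))" if iv: "i \<in> ?N" "v \<in> V i" for A i v
  proof -
    obtain c L where L: "linear L" and \<beta>: "\<beta> i v = (\<lambda>x. c + L x)"
      using aff[OF iv] by blast
    \<comment> \<open>\<open>L\<close> is only known to be linear. Continuity in \<open>t\<close>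
      holds because \<open>L\<close> is evaluated on combinations of finitely many fixed vectors,
      which leaves an affine function of finitely many entries of \<open>t\<close>.\<close>
    have "\<beta> i v ((P t)(i := 0)) =
        c + (\<Sum>l\<in>?N - {i}. \<Sum>w\<in>V l. t (l, w) *\<^sub>R L (\<lambda>j. if j = l then y l w else 0))" for t
      unfolding P_upd \<beta> by (simp add: linear_sum[OF L] linear_scale[OF L])
    then show ?thesis
      by (auto intro!: continuous_intros continuous_on_subset[OF continuous_on_product_coordinates])
  qed
  define s where "s i t = (\<Sum>v\<in>V i. max 0 (\<beta> i v ((P t)(i := 0))))" for i t
  \<comment> \<open>The functionals sum to 1 everywhere, not just on the affine hull of the simplex, so the
    normalising factor never vanishes.\<close>
  have s_ge1: "1 \<le> s i t" if "i \<in> ?N" for i t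
    unfolding s_def sum1[OF that, of "(P t)(i := 0)", symmetric] by (intro sum_mono) simp
  \<comment> \<open>Off the simplex some functionals may be negative; positive parts divided by
    their sum are convex weights for every \<open>t\<close>.\<close>
  define F where "F t = (\<lambda>(i, v). max 0 (\<beta> i v ((P t)(i := 0))) / s i t)" for t
  have F_sum: "(\<Sum>v\<in>V i. F t (i, v)) = 1" if "i \<in> ?N" for i t
    using s_ge1[OF that, of t] by (simp add: F_def s_def flip: sum_divide_distrib)
  have F_nonneg: "0 \<le> F t (i, v)" if "i \<in> ?N" for i v t
    using s_ge1[OF that, of t] by (simp add: F_def)
  have F_le1: "F t (i, v) \<le> 1" if "i \<in> ?N" "v \<in> V i" for i v t
    using member_le_sum[of v "V i" "\<lambda>v. F t (i, v)"] F_nonneg F_sum finV that by auto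
  let ?I = "Sigma ?N V"
  have F_cont: "continuous_on A (\<lambda>t. F t k)" if k: "k \<in> ?I" for A k
  proof -
    obtain i v where iv: "k = (i, v)" "i \<in> ?N" "v \<in> V i"
      using k by blast
    have "s i t \<noteq> 0" for t
      using s_ge1[OF iv(2), of t] by auto
    then show ?thesis
      using \<beta>_cont iv unfolding iv(1) F_def s_def
      by (auto intro!: continuous_intros)
  qed
  obtain t where fixp: "\<And>k. k \<in> ?I \<Longrightarrow> F t k = t k"
    by (rule brouwer_unit_cube[of ?I F]) (use finV F_cont F_nonneg F_le1 in auto)
  have t: "t (i, v) = F t (i, v)" if "i \<in> ?N" "v \<in> V i" for i v
    using fixp that by simp
  \<comment> \<open>Weights in the cube need not sum to 1, so \<open>P\<close> may leave the product
    of the \<open>X i\<close>. At the fixed point they are values of \<open>F\<close>, and convexity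
    of \<open>X i\<close> applies.\<close>
  have P_profile: "P t \<in> profiles ?N X"
  proof -
    have "(\<Sum>v\<in>V i. t (i, v) *\<^sub>R y i v) \<in> X i" if i: "i \<in> ?N" for i
      using a i by (intro convex_sum) (auto simp: finV t F_nonneg F_sum yX)
    then show ?thesis
      by (simp add: profiles_def P_def)
  qed
  have "P t i \<in> upper_section X C i ((P t)(i := 0))"
    if i: "i \<in> ?N" and ne: "upper_section X C i ((P t)(i := 0)) \<noteq> {}" for i
  proof -
    let ?z = "(P t)(i := 0)"
    have zW: "?z \<in> ?W i"
      using P_profile ne by (auto simp: upper_domain_def profiles_def)
    \<comment> \<open>On the simplex the functionals are nonnegative with sum 1, so taking positive
      parts and normalising changes nothing.\<close>
    have "t (i, v) = \<beta> i v ?z" if "v \<in> V i" for v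
      using \<beta>_nonneg[OF i zW] sum1[OF i] that by (simp add: t[OF i] F_def s_def max_absorb2)
    then have "P t i = (\<Sum>v\<in>V i. \<beta> i v ?z *\<^sub>R y i v)"
      using i by (simp add: P_def)
    then show ?thesis
      using y_sel[OF i, of "\<lambda>v. \<beta> i v ?z"] \<beta>_nonneg[OF i zW] sum1[OF i] \<beta>_repr[OF i zW] by simp
  qed
  with P_profile have "equilibrium_in_choice n X C (P t)"
    by (simp add: equilibrium_in_choice_def)
  then show ?thesis by (rule exI[of _ "P t"])
qed

end
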